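(* For $b\geq 1$ let $$A(b)=\sqrt{\tfrac12\sqrt{1+8b^{-2}}+\tfrac12-2b^{-2}}.$$ Then $A(b)<1$ for all $b\ge 1$, and for every $b\geq1$ and every real random variable $X$ with $\mathsf{E}X=0$, $\mathsf{E}X^2=1$, $\mathsf{E}|X|^3=b$, $$\left|\mathsf{E}X^3\right|\leq A(b)\,\mathsf{E}|X|^3,$$ with equality attained for each $b\geq1$ at the two-point distribution $$\mathsf{P}\bigg(X=\pm\Big(\frac{1\mp u}{1\pm u}\Big)^{1/2}\bigg)=\frac{1\pm u}{2},\qquad u=\sqrt{b\sqrt{b^2+8}/2-b^2/2-1}$$ (upper signs taken together and lower signs taken together). Moreover, the function $A(b)$, $b\geq 1$, is concave and strictly increasing, with $0=A(1)\leq A(b)<\lim_{b\to\infty}A(b)=1$ for $b\geq1$. The function $bA(b)$, $b\geq1$, is concave as well.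
   Context: $\mathsf{E}$ denotes mathematical expectation and $\mathsf{P}$ probability. *)

theory Defs
  imports "HOL-Probability.Probability"
begin

definition A_fn :: "real \<Rightarrow> real" where
  "A_fn b = sqrt (1/2 * sqrt (1 + 8 / b\<^sup>2) + 1/2 - 2 / b\<^sup>2)"

definition u_fn :: "real \<Rightarrow> real" where
  "u_fn b = sqrt (b * sqrt (b\<^sup>2 + 8) / 2 - b\<^sup>2 / 2 - 1)"

definition x_plus :: "real \<Rightarrow> real" where
  "x_plus b = sqrt ((1 - u_fn b) / (1 + u_fn b))"

definition x_minus :: "real \<Rightarrow> real" where
  "x_minus b = - sqrt ((1 + u_fn b) / (1 - u_fn b))"

(* Bernoulli distributions are only meaningful for parameters in [0, 1]; here this amounts to
   u_fn b \<in> [-1, 1], and x_minus b divides by zero unless u_fn b \<noteq> 1. *)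
definition two_point :: "real \<Rightarrow> real pmf" where
  "two_point b =
     map_pmf (\<lambda>s. if s then x_plus b else x_minus b) (bernoulli_pmf ((1 + u_fn b) / 2))"

end

theory Submission
  imports Defs "HOL-Real_Asymp.Real_Asymp"
begin

text \<open>
  Write $g(b) = b\,A(b)$ and $r = \sqrt{1-u^2}$. The substitution $u = u(b)$ gives $b = (1+u^2)/r$ and
  $A(b) = 2u/(1+u^2)$. For $|u| \le 1$ the cubic inequality
  $u(3-u^2)\,x^3 \le 2|x|^3 + 3ur^2x - 3r^3x^2 + r^3$ holds for all real $x$, with equality, when
  $0 \le u < 1$, exactly on the mirror image of the two-point support. Taking expectations bounds $|\mathsf{E}X^3|$ by an
  affine function of $\mathsf{E}|X|^3$ whose value at $b$ is $g(b)$; applied to the two-point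
  distributions themselves, the same family of affine bounds shows that $g$ is concave. Concavity of
  $A$ follows since $A^2$ is concave and the square root is concave and increasing.
\<close>

section \<open>Rational parametrisation of b and A(b) by u and r\<close>

text \<open>The square v of \<open>u_fn b\<close> is the nonnegative root of v^2 + (b^2 + 2) v + 1 -
  b^2 = 0, which is the third claim expanded.\<close>

lemma u_fn_bounds:
  assumes "b \<ge> 1"
  shows "0 \<le> u_fn b" "u_fn b < 1"
    and "b\<^sup>2 * (1 - (u_fn b)\<^sup>2) = (1 + (u_fn b)\<^sup>2)\<^sup>2"
proof -
  define q where "q = sqrt (b\<^sup>2 + 8)"
  have q2: "q\<^sup>2 = b\<^sup>2 + 8" and q0: "q \<ge> 0" by (simp_all add: q_def)
  have b2: "1 \<le> b\<^sup>2" using assms by (simp add: one_le_power)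
  define v where "v = b * q / 2 - b\<^sup>2 / 2 - 1"
  have u: "u_fn b = sqrt v" by (simp add: u_fn_def v_def q_def)
  have bq: "(b * q)\<^sup>2 = b\<^sup>2 * b\<^sup>2 + 8 * b\<^sup>2"
    by (simp add: power_mult_distrib q2 algebra_simps)
  \<comment> \<open>Squares are compared: (b q)^2 = b^4 + 8 b^2 lies above (b^2 + 2)^2, because b^2
    >= 1, and below (b^2 + 4)^2.\<close>
  have "b\<^sup>2 + 2 \<le> b * q"
    by (rule power2_le_imp_le) (use b2 assms q0 bq in \<open>auto simp: power2_eq_square algebra_simps\<close>)
  then have v0: "0 \<le> v" by (simp add: v_def)
  have "b * q < b\<^sup>2 + 4"
    by (rule power2_less_imp_less) (use bq in \<open>auto simp: power2_eq_square algebra_simps\<close>)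
  then have v1: "v < 1" by (simp add: v_def)
  show "0 \<le> u_fn b" "u_fn b < 1" using v0 v1 by (simp_all add: u)
  have "(1 + v)\<^sup>2 = ((b * q)\<^sup>2 - 2 * (b * q) * b\<^sup>2 + b\<^sup>2 * b\<^sup>2) / 4"
    by (simp add: v_def power2_eq_square field_simps)
  also have "\<dots> = b\<^sup>2 * (1 - v)"
    unfolding bq by (simp add: v_def field_simps)
  finally show "b\<^sup>2 * (1 - (u_fn b)\<^sup>2) = (1 + (u_fn b)\<^sup>2)\<^sup>2"
    using v0 by (simp add: u)
qed

text \<open>At u = 0 the relation in \<open>u_fn_bounds\<close> reads b^2 = 1. Strict positivity
  later permits cancelling the factor u (3 - u^2).\<close>

lemma u_fn_pos:
  assumes "b > 1"
  shows "0 < u_fn b"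
proof -
  have "b\<^sup>2 \<noteq> 1" using assms by (simp add: power2_eq_1_iff)
  then have "u_fn b \<noteq> 0" using u_fn_bounds(3)[of b] assms by auto
  then show ?thesis using u_fn_bounds(1)[of b] assms by linarith
qed

text \<open>With this r, the quantities b and b A(b) and the two support points all become rational
  in u and r.\<close>

definition r_fn :: "real \<Rightarrow> real" where
  "r_fn b = sqrt (1 - (u_fn b)\<^sup>2)"

lemma r_fn:
  assumes "b \<ge> 1"
  shows "0 < r_fn b" "(r_fn b)\<^sup>2 = 1 - (u_fn b)\<^sup>2" "b = (1 + (u_fn b)\<^sup>2) / r_fn b"
proof -
  note u = u_fn_bounds[OF assms]
  have u2: "(u_fn b)\<^sup>2 < 1" using u(1,2) by (simp add: abs_square_less_1)
  then show r0: "0 < r_fn b" and r2: "(r_fn b)\<^sup>2 = 1 - (u_fn b)\<^sup>2"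
    by (simp_all add: r_fn_def)
  have "b * r_fn b = 1 + (u_fn b)\<^sup>2"
    by (rule power2_eq_imp_eq) (use u(3) r0 r2 assms in \<open>auto simp: power_mult_distrib\<close>)
  then show "b = (1 + (u_fn b)\<^sup>2) / r_fn b" using r0 by (simp add: field_simps)
qed

text \<open>With v = u^2, 1/b^2 is rational in v and both nested radicands become squares: the inner
  one because (1 + v)^2 + 8 (1 - v) = (3 - v)^2, the outer one because it reduces to 4 v / (1 +
  v)^2.\<close>

lemma A_fn_eq:
  assumes "b \<ge> 1"
  shows "A_fn b = 2 * u_fn b / (1 + (u_fn b)\<^sup>2)"
proof -
  define v where "v = (u_fn b)\<^sup>2"
  have v: "0 \<le> v" "v < 1" "b\<^sup>2 * (1 - v) = (1 + v)\<^sup>2"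
    using u_fn_bounds[OF assms] by (auto simp: v_def abs_square_less_1)
  have b2: "1 / b\<^sup>2 = (1 - v) / (1 + v)\<^sup>2"
    using v assms by (simp add: field_simps)
  have "1 + 8 / b\<^sup>2 = 1 + 8 * (1 / b\<^sup>2)" by simp
  also have "\<dots> = ((3 - v) / (1 + v))\<^sup>2"
    unfolding b2 using v by (simp add: divide_simps) (simp add: power2_eq_square algebra_simps)
  finally have s: "sqrt (1 + 8 / b\<^sup>2) = (3 - v) / (1 + v)"
    using v by simp
  have "1/2 * sqrt (1 + 8 / b\<^sup>2) + 1/2 - 2 / b\<^sup>2 = 1/2 * ((3 - v) / (1 + v)) + 1/2 - 2 * (1 / b\<^sup>2)"
    by (simp add: s)
  also have "\<dots> = (2 * u_fn b / (1 + v))\<^sup>2"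
    unfolding b2 using v by (simp add: divide_simps v_def[symmetric]) (simp add: power2_eq_square algebra_simps)
  finally show ?thesis
    using v u_fn_bounds(1)[OF assms] by (simp add: A_fn_def v_def)
qed

lemma A_fn_mult_eq:
  assumes "b \<ge> 1"
  shows "A_fn b * b = 2 * u_fn b / r_fn b"
proof -
  have "1 + (u_fn b)\<^sup>2 > 0" by (simp add: add_pos_nonneg)
  then have "2 * u_fn b / (1 + (u_fn b)\<^sup>2) * ((1 + (u_fn b)\<^sup>2) / r_fn b) = 2 * u_fn b / r_fn b"
    by simp
  then show ?thesis using A_fn_eq[OF assms] r_fn(3)[OF assms] by metis
qed

section \<open>Third-moment bounds from a piecewise cubic inequality\<close>

lemma cubic_certificate:
  fixes u r x :: real
  assumes "\<bar>u\<bar> \<le> 1" "r \<ge> 0"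
  shows "u * (3 - u\<^sup>2) * x ^ 3
           \<le> 2 * \<bar>x\<bar> ^ 3 + 3 * u * r\<^sup>2 * x - 3 * r * (1 - u\<^sup>2) * x\<^sup>2 + r ^ 3"
proof (cases "x \<ge> 0")
  case True
  have "0 \<le> ((1 - u) * x - r)\<^sup>2 * ((2 + u) * x + r)"
    using True assms by (intro mult_nonneg_nonneg[OF zero_le_power2] add_nonneg_nonneg[OF mult_nonneg_nonneg]) auto
  then show ?thesis using True
    by (simp add: power2_eq_square power3_eq_cube algebra_simps)
next
  case False
  have "0 \<le> ((1 + u) * (-x) - r)\<^sup>2 * ((2 - u) * (-x) + r)"
    using False assms by (intro mult_nonneg_nonneg[OF zero_le_power2] add_nonneg_nonneg[OF mult_nonneg_nonneg]) auto
  then show ?thesis using False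
    by (simp add: power2_eq_square power3_eq_cube algebra_simps)
qed

context prob_space
begin

text \<open>Domination by 1 + |X|^3, whose constant term is integrable on a probability
  space.\<close>

lemma integrable_powers_of_cube:
  fixes X :: "'a \<Rightarrow> real"
  assumes [measurable]: "X \<in> borel_measurable M" and 3: "integrable M (\<lambda>\<omega>. \<bar>X \<omega>\<bar> ^ 3)"
  shows "integrable M X" "integrable M (\<lambda>\<omega>. X \<omega> ^ 2)" "integrable M (\<lambda>\<omega>. X \<omega> ^ 3)"
proof -
  have bound: "integrable M (\<lambda>\<omega>. 1 + \<bar>X \<omega>\<bar> ^ 3)" using 3 by simp
  have "\<bar>x\<bar> ^ n \<le> 1 + \<bar>x\<bar> ^ 3" if "n \<le> 3" for x :: real and n
  proof (cases "\<bar>x\<bar> \<le> 1")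
    case True
    then have "\<bar>x\<bar> ^ n \<le> 1" by (simp add: power_le_one)
    then show ?thesis by (simp add: add_increasing2)
  next
    case False
    then have "\<bar>x\<bar> ^ n \<le> \<bar>x\<bar> ^ 3" using that by (intro power_increasing) auto
    then show ?thesis by simp
  qed
  then have *: "integrable M (\<lambda>\<omega>. X \<omega> ^ n)" if "n \<le> 3" for n
    using that by (intro Bochner_Integration.integrable_bound[OF bound]) (auto simp: power_abs)
  show "integrable M X" "integrable M (\<lambda>\<omega>. X \<omega> ^ 2)" "integrable M (\<lambda>\<omega>. X \<omega> ^ 3)"
    using *[of 1] *[of 2] *[of 3] by simp_all
qed

text \<open>Here u is a free parameter, not tied to the law of X: each u yields one bound affine in
  E|X|^3, and the best u for a given b is chosen later.\<close>

lemma third_moment_tangent_bound: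
  fixes X :: "'a \<Rightarrow> real"
  assumes X: "X \<in> borel_measurable M" "integrable M (\<lambda>\<omega>. \<bar>X \<omega>\<bar> ^ 3)"
    and m: "expectation X = 0" "expectation (\<lambda>\<omega>. X \<omega> ^ 2) = 1"
    and u: "0 \<le> u" "u \<le> 1" and r: "r \<ge> 0" "r\<^sup>2 = 1 - u\<^sup>2"
  shows "u * (3 - u\<^sup>2) * \<bar>expectation (\<lambda>\<omega>. X \<omega> ^ 3)\<bar>
           \<le> 2 * expectation (\<lambda>\<omega>. \<bar>X \<omega>\<bar> ^ 3) - 2 * r ^ 3"
proof -
  note [simp] = integrable_powers_of_cube[OF X] X(2)
  \<comment> \<open>\<open>w\<close> stands for u and for -u, which handle the two signs of E
    X^3.\<close>
  have *: "w * (3 - w\<^sup>2) * expectation (\<lambda>\<omega>. X \<omega> ^ 3)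
           \<le> 2 * expectation (\<lambda>\<omega>. \<bar>X \<omega>\<bar> ^ 3) - 2 * r ^ 3" if w: "\<bar>w\<bar> \<le> 1" "r\<^sup>2 = 1 - w\<^sup>2" for w
  proof -
    have "w * (3 - w\<^sup>2) * expectation (\<lambda>\<omega>. X \<omega> ^ 3) = expectation (\<lambda>\<omega>. w * (3 - w\<^sup>2) * X \<omega> ^ 3)"
      by simp
    also have "\<dots> \<le> expectation (\<lambda>\<omega>. 2 * \<bar>X \<omega>\<bar> ^ 3 + 3 * w * r\<^sup>2 * X \<omega>
        - 3 * r * (1 - w\<^sup>2) * (X \<omega>)\<^sup>2 + r ^ 3)"
      by (intro integral_mono) (auto intro!: cubic_certificate w r)
    also have "\<dots> = 2 * expectation (\<lambda>\<omega>. \<bar>X \<omega>\<bar> ^ 3) - 3 * r * (1 - w\<^sup>2) + r ^ 3"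
      using m by (simp add: prob_space)
    \<comment> \<open>Since 1 - w^2 = r^2, the quadratic term contributes -3 r^3.\<close>
    also have "\<dots> = 2 * expectation (\<lambda>\<omega>. \<bar>X \<omega>\<bar> ^ 3) - 2 * r ^ 3"
      using w(2) by (simp add: power3_eq_cube power2_eq_square)
    finally show ?thesis .
  qed
  show ?thesis using *[of u] *[of "-u"] u r by (cases "expectation (\<lambda>\<omega>. X \<omega> ^ 3) \<ge> 0") auto
qed

text \<open>The tangent bound degenerates at $b = 1$ (there $u = 0$), where instead
  $\mathsf{E}\,|X|(|X|-1)^2 \le 0$ forces $X \in \{-1, 0, 1\}$ almost surely.\<close>
lemma third_moment_eq_0:
  fixes X :: "'a \<Rightarrow> real"
  assumes X: "X \<in> borel_measurable M" "integrable M (\<lambda>\<omega>. \<bar>X \<omega>\<bar> ^ 3)"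
    and m: "expectation X = 0" "expectation (\<lambda>\<omega>. X \<omega> ^ 2) = 1"
      "expectation (\<lambda>\<omega>. \<bar>X \<omega>\<bar> ^ 3) = 1"
  shows "expectation (\<lambda>\<omega>. X \<omega> ^ 3) = 0"
proof -
  note [simp] = integrable_powers_of_cube[OF X] X(2)
  note [measurable] = X(1)
  let ?d = "\<lambda>x::real. \<bar>x\<bar> * (\<bar>x\<bar> - 1)\<^sup>2"
  have d: "?d x = \<bar>x\<bar> ^ 3 - 2 * x\<^sup>2 + \<bar>x\<bar>" for x
    by (cases "x \<ge> 0") (simp_all add: power2_eq_square power3_eq_cube algebra_simps)
  have int: "integrable M (\<lambda>\<omega>. ?d (X \<omega>))" unfolding d by simp
  \<comment> \<open>From 2|x| <= x^2 + 1 follows E|X| <= 1, hence the expectation of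
    \<open>?d\<close> is 1 - 2 + E|X| <= 0.\<close>
  have "2 * expectation (\<lambda>\<omega>. \<bar>X \<omega>\<bar>) = expectation (\<lambda>\<omega>. 2 * \<bar>X \<omega>\<bar>)" by simp
  also have "\<dots> \<le> expectation (\<lambda>\<omega>. (X \<omega>)\<^sup>2 + 1)"
  proof (intro integral_mono)
    show "2 * \<bar>X \<omega>\<bar> \<le> (X \<omega>)\<^sup>2 + 1" for \<omega>
      using zero_le_power2[of "\<bar>X \<omega>\<bar> - 1"] by (simp add: power2_diff)
  qed auto
  also have "\<dots> = 2" using m by (simp add: prob_space)
  finally have "expectation (\<lambda>\<omega>. ?d (X \<omega>)) \<le> 0" unfolding d using m by simp
  moreover have "expectation (\<lambda>\<omega>. ?d (X \<omega>)) \<ge> 0"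
    by (intro Bochner_Integration.integral_nonneg) simp
  ultimately have "AE \<omega> in M. ?d (X \<omega>) = 0"
    using integral_nonneg_eq_0_iff_AE[OF int] by simp
  \<comment> \<open>The zeros of \<open>?d\<close> are exactly the solutions of x^3 = x, which turns
    the third moment into the first.\<close>
  then have "AE \<omega> in M. X \<omega> ^ 3 = X \<omega>"
    by eventually_elim (auto simp: abs_if power3_eq_cube split: if_splits)
  then have "expectation (\<lambda>\<omega>. X \<omega> ^ 3) = expectation X" by (intro integral_cong_AE) auto
  then show ?thesis using m by simp
qed

end

text \<open>The affine bound with parameter \<open>u_fn b\<close> meets the curve b A(b), scaled by
  u (3 - u^2), at b itself: both sides equal 2 u^2 (3 - u^2) / r.\<close>

lemma tangent_value:
  assumes "b \<ge> 1"
  shows "u_fn b * (3 - (u_fn b)\<^sup>2) * (A_fn b * b) = 2 * b - 2 * r_fn b ^ 3"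
proof -
  define u r where "u = u_fn b" and "r = r_fn b"
  have r: "r > 0" "r\<^sup>2 = 1 - u\<^sup>2" "b = (1 + u\<^sup>2) / r" using r_fn[OF assms] by (auto simp: u_def r_def)
  \<comment> \<open>Written as r^4 / r, so that r survives only as a denominator.\<close>
  have "r ^ 3 = (1 - u\<^sup>2)\<^sup>2 / r"
    using r(1) by (simp add: r(2)[symmetric] field_simps flip: power_mult power_Suc2 power_Suc)
  have "2 * b - 2 * r ^ 3 = u * (3 - u\<^sup>2) * (2 * u / r)"
    unfolding r(3) \<open>r ^ 3 = _\<close> using r(1)
    by (simp add: field_simps) (simp add: power2_eq_square algebra_simps)
  then show ?thesis using A_fn_mult_eq[OF assms] by (simp add: u_def r_def)
qed

text \<open>For b > 1 the parameter \<open>u_fn b\<close> turns the affine bound into the claim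
  multiplied by the positive factor u (3 - u^2), which is then cancelled.\<close>

lemma (in prob_space) third_moment_bound:
  fixes X :: "'a \<Rightarrow> real"
  assumes b: "b \<ge> 1"
    and X: "X \<in> borel_measurable M" "integrable M (\<lambda>\<omega>. \<bar>X \<omega>\<bar> ^ 3)"
    and m: "expectation X = 0" "expectation (\<lambda>\<omega>. X \<omega> ^ 2) = 1"
      "expectation (\<lambda>\<omega>. \<bar>X \<omega>\<bar> ^ 3) = b"
  shows "\<bar>expectation (\<lambda>\<omega>. X \<omega> ^ 3)\<bar> \<le> A_fn b * b"
proof (cases "b = 1")
  case True
  then show ?thesis using third_moment_eq_0[OF X m(1,2)] m(3) by (simp add: A_fn_def)
next
  case False
  then have u: "0 < u_fn b" "u_fn b < 1" using u_fn_pos[of b] u_fn_bounds[OF b] b by auto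
  then have "(u_fn b)\<^sup>2 < 1" by (simp add: abs_square_less_1)
  then have K: "0 < u_fn b * (3 - (u_fn b)\<^sup>2)" using u by simp
  have "u_fn b * (3 - (u_fn b)\<^sup>2) * \<bar>expectation (\<lambda>\<omega>. X \<omega> ^ 3)\<bar> \<le> 2 * b - 2 * r_fn b ^ 3"
    using third_moment_tangent_bound[OF X m(1,2), of "u_fn b" "r_fn b"] u r_fn(1,2)[OF b] m(3)
    by simp
  then have "u_fn b * (3 - (u_fn b)\<^sup>2) * \<bar>expectation (\<lambda>\<omega>. X \<omega> ^ 3)\<bar>
      \<le> u_fn b * (3 - (u_fn b)\<^sup>2) * (A_fn b * b)"
    unfolding tangent_value[OF b] .
  then show ?thesis using K by (rule mult_left_le_imp_le)
qed

section \<open>The extremal two-point distribution\<close>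

text \<open>Extending each fraction by its denominator turns the numerator into 1 - u^2 =
  r^2.\<close>

lemma x_plus_minus_eq:
  assumes "b \<ge> 1"
  shows "x_plus b = r_fn b / (1 + u_fn b)" "x_minus b = - (r_fn b / (1 - u_fn b))"
proof -
  note u = u_fn_bounds[OF assms] and r = r_fn[OF assms]
  have "(1 - u_fn b) / (1 + u_fn b) = (r_fn b / (1 + u_fn b))\<^sup>2"
    using u(1,2) by (simp add: power_divide r(2) divide_simps) (simp add: power2_eq_square algebra_simps)
  then show "x_plus b = r_fn b / (1 + u_fn b)" using u r(1) by (simp add: x_plus_def)
  have "(1 + u_fn b) / (1 - u_fn b) = (r_fn b / (1 - u_fn b))\<^sup>2"
    using u(1,2) by (simp add: power_divide r(2) divide_simps) (simp add: power2_eq_square algebra_simps)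
  then show "x_minus b = - (r_fn b / (1 - u_fn b))" using u r(1) by (simp add: x_minus_def)
qed

lemma two_point_integrable:
  fixes f :: "real \<Rightarrow> real"
  shows "integrable (two_point b) f"
  by (intro integrable_measure_pmf_finite) (simp add: two_point_def)

lemma two_point_expectation:
  fixes f :: "real \<Rightarrow> real"
  assumes "b \<ge> 1"
  shows "measure_pmf.expectation (two_point b) f
    = f (x_plus b) * ((1 + u_fn b) / 2) + f (x_minus b) * ((1 - u_fn b) / 2)"
proof -
  have "1 - (1 + u_fn b) / 2 = (1 - u_fn b) / 2" by (simp add: field_simps)
  then show ?thesis using u_fn_bounds[OF assms] by (simp add: two_point_def)
qed

text \<open>The support points have opposite signs, so the map from Booleans is injective and the
  masses do not merge.\<close>

lemma two_point_pmf:
  assumes "b \<ge> 1"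
  shows "pmf (two_point b) (x_plus b) = (1 + u_fn b) / 2"
    and "pmf (two_point b) (x_minus b) = (1 - u_fn b) / 2"
proof -
  note u = u_fn_bounds[OF assms] and r = r_fn[OF assms] and x = x_plus_minus_eq[OF assms]
  let ?h = "\<lambda>s. if s then x_plus b else x_minus b"
  have "x_plus b > 0" "x_minus b < 0" using u r(1) by (simp_all add: x)
  then have "inj ?h" by (auto simp: inj_def)
  from pmf_map_inj'[OF this] have *: "pmf (two_point b) (?h s) = pmf (bernoulli_pmf ((1 + u_fn b) / 2)) s" for s
    by (simp add: two_point_def)
  show "pmf (two_point b) (x_plus b) = (1 + u_fn b) / 2" using *[of True] u by simp
  show "pmf (two_point b) (x_minus b) = (1 - u_fn b) / 2" using *[of False] u by (simp add: field_simps)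
qed

text \<open>The atoms contribute (1 - u)^2 / (2 r) and (1 + u)^2 / (2 r) to E|X|^3. Their sum is b
  and their difference gives E X^3 = -2 u / r, so it is the lower bound on E X^3 that is
  attained.\<close>

lemma two_point_moments:
  assumes "b \<ge> 1"
  shows "measure_pmf.expectation (two_point b) (\<lambda>x. x) = 0"
    and "measure_pmf.expectation (two_point b) (\<lambda>x. x ^ 2) = 1"
    and "measure_pmf.expectation (two_point b) (\<lambda>x. \<bar>x\<bar> ^ 3) = b"
    and "\<bar>measure_pmf.expectation (two_point b) (\<lambda>x. x ^ 3)\<bar> = A_fn b * b"
proof -
  define u r where "u = u_fn b" and "r = r_fn b"
  have u: "0 \<le> u" "u < 1" using u_fn_bounds[OF assms] by (auto simp: u_def)
  have r: "r > 0" "r\<^sup>2 = (1 - u) * (1 + u)" "b = (1 + u\<^sup>2) / r"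
    using r_fn[OF assms] by (auto simp: u_def r_def power2_eq_square algebra_simps)
  note E = two_point_expectation[OF assms, folded u_def, unfolded x_plus_minus_eq[OF assms],
      folded u_def r_def]
  have r3: "r ^ 3 = ((1 - u) * (1 + u))\<^sup>2 / r"
    using r(1) by (simp add: r(2)[symmetric] field_simps flip: power_mult power_Suc2 power_Suc)
  have p: "(r / (1 + u)) ^ 3 * ((1 + u) / 2) = (1 - u)\<^sup>2 / (2 * r)"
    unfolding power_divide r3 using u r(1) by (simp add: power2_eq_square power3_eq_cube divide_simps)
  have q: "(r / (1 - u)) ^ 3 * ((1 - u) / 2) = (1 + u)\<^sup>2 / (2 * r)"
    unfolding power_divide r3 using u r(1) by (simp add: power2_eq_square power3_eq_cube divide_simps)
  show "measure_pmf.expectation (two_point b) (\<lambda>x. x) = 0"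
    unfolding E using u by simp
  show "measure_pmf.expectation (two_point b) (\<lambda>x. x ^ 2) = 1"
  proof -
    have "(r / (1 + u))\<^sup>2 * ((1 + u) / 2) = (1 - u) / 2" "(r / (1 - u))\<^sup>2 * ((1 - u) / 2) = (1 + u) / 2"
      unfolding power_divide r(2) using u by (simp_all add: power2_eq_square)
    then show ?thesis unfolding E power2_minus by (simp only:) (simp add: field_simps)
  qed
  have "measure_pmf.expectation (two_point b) (\<lambda>x. \<bar>x\<bar> ^ 3) = (1 - u)\<^sup>2 / (2 * r) + (1 + u)\<^sup>2 / (2 * r)"
    unfolding E p[symmetric] q[symmetric] using u r(1) by simp
  also have "\<dots> = b"
    unfolding r(3) using r(1) by (simp add: field_simps) (simp add: power2_eq_square algebra_simps)
  finally show "measure_pmf.expectation (two_point b) (\<lambda>x. \<bar>x\<bar> ^ 3) = b" .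
  have "measure_pmf.expectation (two_point b) (\<lambda>x. x ^ 3) = (1 - u)\<^sup>2 / (2 * r) - (1 + u)\<^sup>2 / (2 * r)"
    unfolding E p[symmetric] q[symmetric] by simp
  also have "\<dots> = - (2 * u / r)"
    using r(1) by (simp add: field_simps) (simp add: power2_eq_square algebra_simps)
  finally show "\<bar>measure_pmf.expectation (two_point b) (\<lambda>x. x ^ 3)\<bar> = A_fn b * b"
    using u r(1) A_fn_mult_eq[OF assms] by (simp add: u_def r_def)
qed

section \<open>Concavity of b A(b)\<close>

text \<open>For z > 1 the line (2 b - c) / K lies above b A(b) for all b >= 1 and touches it at b =
  z. Evaluating this supporting line at x and y gives concavity.\<close>

lemma concave_on_mult_A_fn: "concave_on {1..} (\<lambda>b. b * A_fn b)"
proof (rule concave_on_linorderI)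
  fix t x y :: real
  assume t: "0 < t" "t < 1" and x: "x \<in> {1..}" and y: "y \<in> {1..}" and xy: "x < y"
  define z where "z = (1 - t) * x + t * y"
  have "z = x + t * (y - x)" by (simp add: z_def algebra_simps)
  \<comment> \<open>Being strictly between x and y keeps z off the endpoint 1, where K would
    vanish.\<close>
  then have "z > x" using t xy by simp
  then have z: "z > 1" using x by simp
  define K c where "K = u_fn z * (3 - (u_fn z)\<^sup>2)" and "c = 2 * r_fn z ^ 3"
  have u: "0 < u_fn z" "u_fn z < 1" using u_fn_pos[OF z] u_fn_bounds[of z] z by auto
  then have "(u_fn z)\<^sup>2 < 1" by (simp add: abs_square_less_1)
  then have K: "0 < K" using u by (simp add: K_def)
  \<comment> \<open>The parameter belongs to z but the law to b: the two-point law realises b A(b)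
    as |E X^3|, so the moment bound becomes a statement about the function alone.\<close>
  have tangent: "K * (b * A_fn b) \<le> 2 * b - c" if "b \<ge> 1" for b
    using measure_pmf.third_moment_tangent_bound[of "\<lambda>x. x" "two_point b" "u_fn z" "r_fn z"]
      two_point_moments[OF that] two_point_integrable u r_fn(1,2)[of z] z
    by (simp add: K_def c_def mult.commute)
  have "K * ((1 - t) * (x * A_fn x) + t * (y * A_fn y))
      = (1 - t) * (K * (x * A_fn x)) + t * (K * (y * A_fn y))" by (simp add: algebra_simps)
  also have "\<dots> \<le> (1 - t) * (2 * x - c) + t * (2 * y - c)"
    using t x y by (intro add_mono mult_left_mono tangent) auto
  also have "\<dots> = 2 * z - c" by (simp add: z_def algebra_simps)
  also have "\<dots> = K * (z * A_fn z)"
    using tangent_value[of z] z by (simp add: K_def c_def mult.commute)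
  finally have "(1 - t) * (x * A_fn x) + t * (y * A_fn y) \<le> z * A_fn z"
    using K by (rule mult_left_le_imp_le)
  then show "(1 - t) * (x * A_fn x) + t * (y * A_fn y)
      \<le> ((1 - t) *\<^sub>R x + t *\<^sub>R y) * A_fn ((1 - t) *\<^sub>R x + t *\<^sub>R y)"
    by (simp add: z_def)
qed (rule convex_real_interval)

section \<open>Monotonicity and concavity of A through its square\<close>

lemma concave_on_sqrt_comp:
  assumes f: "concave_on S f" and nonneg: "\<And>x. x \<in> S \<Longrightarrow> 0 \<le> f x"
  shows "concave_on S (\<lambda>x. sqrt (f x))"
  unfolding concave_on_iff
proof (intro conjI ballI allI impI)
  show "convex S" using f by (simp add: concave_on_iff)
  fix x y and u v :: real
  assume xy: "x \<in> S" "y \<in> S" and uv: "0 \<le> u" "0 \<le> v" "u + v = 1"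
  define p q where "p = sqrt (f x)" and "q = sqrt (f y)"
  have pq: "p\<^sup>2 = f x" "q\<^sup>2 = f y" using nonneg xy by (auto simp: p_def q_def)
  have v: "v = 1 - u" using uv by simp
  \<comment> \<open>This is the variance of a variable with values p and q taken with weights u and
    v.\<close>
  have "u * p\<^sup>2 + v * q\<^sup>2 - (u * p + v * q)\<^sup>2 = u * v * (p - q)\<^sup>2"
    unfolding v by (simp add: power2_eq_square algebra_simps)
  also have "\<dots> \<ge> 0" using uv by simp
  finally have "(u * p + v * q)\<^sup>2 \<le> u * f x + v * f y" by (simp add: pq)
  also have "\<dots> \<le> f (u *\<^sub>R x + v *\<^sub>R y)" using f xy uv by (auto simp: concave_on_iff)
  finally show "u * sqrt (f x) + v * sqrt (f y) \<le> sqrt (f (u *\<^sub>R x + v *\<^sub>R y))"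
    by (simp add: p_def q_def real_le_rsqrt)
qed

text \<open>A vanishes at 1 with infinite slope there, whereas its square is differentiable at every
  b >= 1.\<close>

definition A_sq :: "real \<Rightarrow> real" where
  "A_sq b = 1/2 * sqrt (1 + 8 / b\<^sup>2) + 1/2 - 2 / b\<^sup>2"

text \<open>The factored form shows two positive factors that both decrease for b >= 1, from which
  sign and antitonicity are read off.\<close>

definition A_sq' :: "real \<Rightarrow> real" where
  "A_sq' b = 4 / b ^ 3 * (1 - 1 / sqrt (1 + 8 / b\<^sup>2))"

lemma A_fn_sqrt: "A_fn b = sqrt (A_sq b)"
  by (simp add: A_fn_def A_sq_def)

lemma A_sq_deriv:
  assumes "b \<ge> 1"
  shows "(A_sq has_real_derivative A_sq' b) (at b)"
proof -
  have "1 + 8 / b\<^sup>2 > 0" by (simp add: add_pos_nonneg)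
  then show ?thesis
    unfolding A_sq_def [abs_def] A_sq'_def using assms
    by (auto intro!: derivative_eq_intros simp: power2_eq_square power3_eq_cube field_simps)
qed

lemma inverse_sqrt_less_1:
  fixes b :: real
  assumes "b \<ge> 1"
  shows "1 / sqrt (1 + 8 / b\<^sup>2) < 1"
proof -
  have "1 < sqrt (1 + 8 / b\<^sup>2)" using assms by simp
  then show ?thesis using divide_less_eq_1_pos[of "sqrt (1 + 8 / b\<^sup>2)" 1] by linarith
qed

lemma A_sq'_pos:
  assumes "b \<ge> 1"
  shows "0 < A_sq' b"
  unfolding A_sq'_def using assms inverse_sqrt_less_1[OF assms] by (intro mult_pos_pos) auto

lemma A_sq'_antimono:
  assumes "1 \<le> x" "x \<le> y"
  shows "A_sq' y \<le> A_sq' x"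
proof -
  have "8 / y\<^sup>2 \<le> 8 / x\<^sup>2" using assms by (intro divide_left_mono power_mono mult_pos_pos) auto
  then have "1 / sqrt (1 + 8 / x\<^sup>2) \<le> 1 / sqrt (1 + 8 / y\<^sup>2)"
    by (intro divide_left_mono mult_pos_pos) (auto simp: add_pos_nonneg)
  moreover have "4 / y ^ 3 \<le> 4 / x ^ 3" using assms by (intro divide_left_mono power_mono mult_pos_pos) auto
  ultimately show ?thesis unfolding A_sq'_def using assms
    using inverse_sqrt_less_1[of y] by (intro mult_mono) auto
qed

lemma A_sq_1: "A_sq 1 = 0"
  by (simp add: A_sq_def)

lemma A_sq_strict_mono: "strict_mono_on {1..} A_sq"
proof (rule strict_mono_onI)
  fix x y :: real
  assume "x \<in> {1..}" "y \<in> {1..}" "x < y"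
  then show "A_sq x < A_sq y"
    by (intro DERIV_pos_imp_increasing[of x y A_sq]) (force intro!: A_sq_deriv A_sq'_pos)+
qed

lemma A_sq_nonneg:
  assumes "b \<ge> 1"
  shows "0 \<le> A_sq b"
  using strict_mono_on_leD[OF A_sq_strict_mono, of 1 b] assms by (simp add: A_sq_1)

lemma A_sq_concave: "concave_on {1..} A_sq"
  unfolding concave_on_def
proof (rule convex_on_realI)
  show "((\<lambda>x. - A_sq x) has_real_derivative - A_sq' x) (at x)" if "x \<in> {1..}" for x
    using that by (intro DERIV_minus A_sq_deriv) simp
qed (auto intro: A_sq'_antimono)

text \<open>In terms of u the claim is 2 u < 1 + u^2, that is (1 - u)^2 > 0.\<close>

lemma A_fn_less_1:
  assumes "b \<ge> 1"
  shows "A_fn b < 1"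
proof -
  have "1 + u_fn b ^ 2 > 0" by (simp add: add_pos_nonneg)
  moreover have "0 < (1 - u_fn b)\<^sup>2" using u_fn_bounds[OF assms] by simp
  ultimately show ?thesis unfolding A_fn_eq[OF assms] by (simp add: power2_diff)
qed

text \<open>In the equality clause, 0 <= u < 1 certifies that the Bernoulli parameter is a
  probability and that \<open>x_minus\<close> involves no division by zero.\<close>

theorem theorem2:
  shows "(\<forall>b\<ge>1. A_fn b < 1) \<and>
    (\<forall>b\<ge>1. \<forall>(M :: 'a measure) (X :: 'a \<Rightarrow> real).
       prob_space M \<longrightarrow> X \<in> borel_measurable M \<longrightarrow>
       integrable M (\<lambda>\<omega>. \<bar>X \<omega>\<bar> ^ 3) \<longrightarrow>
       prob_space.expectation M X = 0 \<longrightarrow>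
       prob_space.expectation M (\<lambda>\<omega>. X \<omega> ^ 2) = 1 \<longrightarrow>
       prob_space.expectation M (\<lambda>\<omega>. \<bar>X \<omega>\<bar> ^ 3) = b \<longrightarrow>
       \<bar>prob_space.expectation M (\<lambda>\<omega>. X \<omega> ^ 3)\<bar>
         \<le> A_fn b * prob_space.expectation M (\<lambda>\<omega>. \<bar>X \<omega>\<bar> ^ 3)) \<and>
    (\<forall>b\<ge>1. 0 \<le> u_fn b \<and> u_fn b < 1 \<and>
       pmf (two_point b) (x_plus b) = (1 + u_fn b) / 2 \<and>
       pmf (two_point b) (x_minus b) = (1 - u_fn b) / 2 \<and>
       measure_pmf.expectation (two_point b) (\<lambda>x. x) = 0 \<and>
       measure_pmf.expectation (two_point b) (\<lambda>x. x ^ 2) = 1 \<and>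
       measure_pmf.expectation (two_point b) (\<lambda>x. \<bar>x\<bar> ^ 3) = b \<and>
       \<bar>measure_pmf.expectation (two_point b) (\<lambda>x. x ^ 3)\<bar>
         = A_fn b * measure_pmf.expectation (two_point b) (\<lambda>x. \<bar>x\<bar> ^ 3)) \<and>
    concave_on {1..} A_fn \<and>
    strict_mono_on {1..} A_fn \<and>
    A_fn 1 = 0 \<and>
    (\<forall>b\<ge>1. 0 \<le> A_fn b \<and> A_fn b < 1) \<and>
    (A_fn \<longlongrightarrow> 1) at_top \<and>
    concave_on {1..} (\<lambda>b. b * A_fn b)"
proof -
  have bound: "\<bar>prob_space.expectation M (\<lambda>\<omega>. X \<omega> ^ 3)\<bar>
      \<le> A_fn b * prob_space.expectation M (\<lambda>\<omega>. \<bar>X \<omega>\<bar> ^ 3)"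
    if "b \<ge> 1" "prob_space M" "X \<in> borel_measurable M" "integrable M (\<lambda>\<omega>. \<bar>X \<omega>\<bar> ^ 3)"
      "prob_space.expectation M X = 0" "prob_space.expectation M (\<lambda>\<omega>. X \<omega> ^ 2) = 1"
      "prob_space.expectation M (\<lambda>\<omega>. \<bar>X \<omega>\<bar> ^ 3) = b"
    for b and M :: "'a measure" and X :: "'a \<Rightarrow> real"
    using prob_space.third_moment_bound[OF that(2,1,3-7)] that(7) by simp
  have extremal: "0 \<le> u_fn b \<and> u_fn b < 1 \<and>
       pmf (two_point b) (x_plus b) = (1 + u_fn b) / 2 \<and>
       pmf (two_point b) (x_minus b) = (1 - u_fn b) / 2 \<and>
       measure_pmf.expectation (two_point b) (\<lambda>x. x) = 0 \<and>
       measure_pmf.expectation (two_point b) (\<lambda>x. x ^ 2) = 1 \<and>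
       measure_pmf.expectation (two_point b) (\<lambda>x. \<bar>x\<bar> ^ 3) = b \<and>
       \<bar>measure_pmf.expectation (two_point b) (\<lambda>x. x ^ 3)\<bar>
         = A_fn b * measure_pmf.expectation (two_point b) (\<lambda>x. \<bar>x\<bar> ^ 3)" if "b \<ge> 1" for b
    using that u_fn_bounds two_point_pmf two_point_moments by simp
  have concave: "concave_on {1..} A_fn"
    unfolding A_fn_sqrt [abs_def]
    by (rule concave_on_sqrt_comp[OF A_sq_concave]) (simp add: A_sq_nonneg)
  have mono: "strict_mono_on {1..} A_fn"
    using A_sq_strict_mono by (auto simp: strict_mono_on_def A_fn_sqrt)
  have zero: "A_fn 1 = 0" by (simp add: A_fn_sqrt A_sq_1)
  have range: "0 \<le> A_fn b \<and> A_fn b < 1" if "b \<ge> 1" for b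
    using that by (simp add: A_fn_less_1) (simp add: A_fn_sqrt A_sq_nonneg)
  have limit: "(A_fn \<longlongrightarrow> 1) at_top"
    unfolding A_fn_def [abs_def] by real_asymp
  show ?thesis
    \<comment> \<open>Four conjuncts quantified over b remain; the premises of the rules are exactly
      the assumptions introduced.\<close>
    by (intro conjI concave mono zero limit concave_on_mult_A_fn; intro allI impI)
      (rule A_fn_less_1 bound extremal range; assumption)+
qed

end
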